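(* Let $m,n\ge1$ be integers, $N=m+n$, and let $0<\lambda_1<\cdots<\lambda_m$ be real numbers. With $E_l$, $c_j$, $\widetilde E_k$ and $f_k$ as defined in the context, 1. $\displaystyle\prod_{k=0}^{n-1}f_k\ \ge\ \Bigl(\prod_{k=0}^{n-1}c_k\Bigr)\Bigl(\sum_{l=0}^m\Bigl(\prod_{j=0}^{l-1}\lambda_{m-j}\Bigr)E_l\Bigr)^n$; 2. $\displaystyle\prod_{k=0}^{n-1}f_k\ \ge\ \Bigl(\prod_{k=0}^{n-1}c_k\Bigr)\prod_{i=1}^{m}(1+\lambda_i^2)^n$.
   Context: $E_l=e_l(\lambda_1,\dots,\lambda_m)$ is the $l$-th elementary symmetric polynomial ($E_0=1$). The numbers $c_0,\dots,c_{n-1}$ are the coefficients of $$h(y)=\prod_{s=1}^{n-1}\bigl(y-\mathrm i\,e^{\pi \mathrm i s/n}\bigr)=\sum_{j=0}^{n-1}c_j\,y^{n-1-j}\qquad(\mathrm i=\sqrt{-1});$$ they are positive reals, $c_j=\prod_{k=1}^j\cot\frac{k\pi}{2n}$. The numbers $\widetilde E_k$ are defined by $$h(y)\prod_{i=1}^m(y+\lambda_i)=\sum_{k=0}^{N-1}\widetilde E_k\,y^{N-1-k},$$ with $\widetilde E_k=0$ for $k\ge N$. For $0\le k<n$, $$f_k=\sum_{s\ge0,\ k+sn\le N-1}\Bigl(\prod_{j=1}^s\lambda_{N-jn-k}^{\,n}\Bigr)\widetilde E_{k+sn}.$$ (In the geometric situation, $\lambda_i=a_i+\sqrt{1+a_i^2}$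 for $a_1<\cdots<a_m$, coming from $m$ points on a line and $n$ points forming a regular $n$-gon in a plane perpendicular to the line and centred on it.) *)

theory Defs
  imports "HOL-Analysis.Analysis" "HOL-Computational_Algebra.Polynomial"
begin

text \<open>
  A tuple \<open>\<lambda>\<^sub>1, \<dots>, \<lambda>\<^sub>m\<close> is a function \<open>l :: nat \<Rightarrow> real\<close> of which only the
  values at \<open>1, \<dots>, m\<close> are used.
\<close>

definition elem_sym :: "nat \<Rightarrow> (nat \<Rightarrow> real) \<Rightarrow> nat \<Rightarrow> real" where
  "elem_sym m l r = (\<Sum>S | S \<subseteq> {1..m} \<and> card S = r. \<Prod>i\<in>S. l i)"

definition h_poly :: "nat \<Rightarrow> complex poly" where
  "h_poly n = (\<Prod>s=1..n-1. [:- (\<i> * exp (\<i> * complex_of_real (pi * real s / real n))), 1:])"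

text \<open>
  The coefficients of \<open>h_poly n\<close> are real; \<open>Re\<close> only changes the type (see
  \<open>of_real_c_coeff\<close> and \<open>of_real_E_tilde\<close> below).
\<close>

definition c_coeff :: "nat \<Rightarrow> nat \<Rightarrow> real" where
  "c_coeff n j = Re (coeff (h_poly n) (n - 1 - j))"

definition hl_poly :: "nat \<Rightarrow> nat \<Rightarrow> (nat \<Rightarrow> real) \<Rightarrow> complex poly" where
  "hl_poly m n l = h_poly n * (\<Prod>i=1..m. [:complex_of_real (l i), 1:])"

definition E_tilde :: "nat \<Rightarrow> nat \<Rightarrow> (nat \<Rightarrow> real) \<Rightarrow> nat \<Rightarrow> real" where
  "E_tilde m n l k =
     (if k < m + n then Re (coeff (hl_poly m n l) (m + n - 1 - k)) else 0)"

text \<open>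
  The index \<open>m + n - j * n - k\<close> lies in \<open>{1..m}\<close> whenever \<open>1 \<le> j \<le> s\<close> and
  \<open>k + s * n \<le> m + n - 1\<close>, so the subtraction never truncates.
\<close>

definition f_num :: "nat \<Rightarrow> nat \<Rightarrow> (nat \<Rightarrow> real) \<Rightarrow> nat \<Rightarrow> real" where
  "f_num m n l k =
     (\<Sum>s | k + s * n \<le> m + n - 1.
        (\<Prod>j=1..s. l (m + n - j * n - k) ^ n) * E_tilde m n l (k + s * n))"

lemma cnj_i_exp:
  assumes "1 \<le> s" "s \<le> n - 1"
  shows "cnj (\<i> * exp (\<i> * complex_of_real (pi * real s / real n))) =
         \<i> * exp (\<i> * complex_of_real (pi * real (n - s) / real n))"
proof -
  have "pi * real (n - s) / real n = pi - pi * real s / real n"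
    using assms by (simp add: of_nat_diff field_simps)
  then show ?thesis
    unfolding cis_conv_exp [symmetric] by (simp only: complex_eq_iff) simp
qed

lemma map_poly_cnj_mult: "map_poly cnj (p * q) = map_poly cnj p * map_poly cnj q"
  by (intro poly_eqI) (simp add: coeff_map_poly coeff_mult)

lemma map_poly_cnj_prod: "map_poly cnj (prod f A) = (\<Prod>i\<in>A. map_poly cnj (f i))"
  by (induction A rule: infinite_finite_induct) (simp_all add: map_poly_cnj_mult)

lemma map_poly_cnj_h_poly: "map_poly cnj (h_poly n) = h_poly n"
proof -
  let ?r = "\<lambda>s. \<i> * exp (\<i> * complex_of_real (pi * real s / real n))"
  have "map_poly cnj (h_poly n) = (\<Prod>s=1..n-1. [:- cnj (?r s), 1:])"
    unfolding h_poly_def map_poly_cnj_prod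
    by (intro prod.cong refl) (simp add: map_poly_pCons)
  also have "\<dots> = (\<Prod>s=1..n-1. [:- ?r (n - s), 1:])"
    by (intro prod.cong refl, subst cnj_i_exp) auto
  also have "\<dots> = h_poly n"
    unfolding h_poly_def
    by (rule prod.reindex_bij_witness [where i = "\<lambda>s. n - s" and j = "\<lambda>s. n - s"]) auto
  finally show ?thesis .
qed

lemma map_poly_cnj_hl_poly: "map_poly cnj (hl_poly m n l) = hl_poly m n l"
  by (simp add: hl_poly_def map_poly_cnj_mult map_poly_cnj_h_poly map_poly_cnj_prod map_poly_pCons)

lemma of_real_Re_coeff:
  assumes "map_poly cnj p = p"
  shows "complex_of_real (Re (coeff p k)) = coeff p k"
proof -
  have "cnj (coeff p k) = coeff p k"
    using arg_cong [OF assms, of "\<lambda>q. coeff q k"] by (simp add: coeff_map_poly)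
  then show ?thesis
    by (simp add: complex_eq_iff)
qed

lemma of_real_c_coeff: "complex_of_real (c_coeff n j) = coeff (h_poly n) (n - 1 - j)"
  by (simp add: c_coeff_def of_real_Re_coeff map_poly_cnj_h_poly)

lemma of_real_E_tilde:
  "k < m + n \<Longrightarrow> complex_of_real (E_tilde m n l k) = coeff (hl_poly m n l) (m + n - 1 - k)"
  by (simp add: E_tilde_def of_real_Re_coeff map_poly_cnj_hl_poly)

end

theory Submission
  imports Defs
begin

text \<open>
  Each \<open>f\<^sub>k\<close> dominates a combination of the \<open>E\<^sub>r\<close> with nonnegative coefficients
  \<open>w\<^sub>k\<^sub>r c\<^sub>j\<close>. For fixed \<open>r\<close>, as \<open>k\<close> runs over the residues modulo \<open>n\<close>, so does the index \<open>j\<close>,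
  and the weights \<open>w\<^sub>k\<^sub>r\<close> multiply to the \<open>n\<close>-th power of the product of the \<open>r\<close> largest
  \<open>\<lambda>\<^sub>i\<close>. Hoelder's inequality applied to the product of the \<open>f\<^sub>k\<close> gives the first claim.
  The second follows since the product of the \<open>r\<close> largest \<open>\<lambda>\<^sub>i\<close> bounds every monomial of \<open>E\<^sub>r\<close>,
  so that the inner sum is at least \<open>\<Sum>\<^sub>X \<Prod>\<^sub>i\<^sub>\<in>\<^sub>X \<lambda>\<^sub>i\<^sup>2 = \<Prod>\<^sub>i (1 + \<lambda>\<^sub>i\<^sup>2)\<close>.
\<close>

section \<open>Hoelder's inequality for finitely many factors\<close>

text \<open>Here \<open>b i\<close> is the geometric mean of the \<open>a k i\<close> over
  \<open>k\<close>, given root-free by \<open>ab\<close>. AM-GM is applied for each \<open>i\<close>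
  to the values \<open>a k i\<close> normalised by their row sums over \<open>I\<close>, then summed
  over \<open>i\<close>; a vanishing row sum forces \<open>b = 0\<close> and is treated
  first.\<close>

lemma Holder_prod_sum:
  fixes a :: "'k \<Rightarrow> 'i \<Rightarrow> real" and b :: "'i \<Rightarrow> real"
  assumes "finite K" "K \<noteq> {}" "finite I"
    and a: "\<And>k i. k \<in> K \<Longrightarrow> i \<in> I \<Longrightarrow> a k i \<ge> 0"
    and b: "\<And>i. i \<in> I \<Longrightarrow> b i \<ge> 0"
    and ab: "\<And>i. i \<in> I \<Longrightarrow> b i ^ card K = (\<Prod>k\<in>K. a k i)"
  shows "(\<Sum>i\<in>I. b i) ^ card K \<le> (\<Prod>k\<in>K. \<Sum>i\<in>I. a k i)"
proof (cases "\<exists>k\<in>K. (\<Sum>i\<in>I. a k i) = 0")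
  case True
  then obtain k where k: "k \<in> K" "(\<Sum>i\<in>I. a k i) = 0" by blast
  then have "a k i = 0" if "i \<in> I" for i
    using that a \<open>finite I\<close> by (simp add: sum_nonneg_eq_0_iff)
  then have "b i = 0" if "i \<in> I" for i
    using ab[OF that] that k(1) \<open>finite K\<close> \<open>K \<noteq> {}\<close> by (metis prod_zero power_eq_0_iff)
  then have "(\<Sum>i\<in>I. b i) = 0" by simp
  then show ?thesis
    using assms by (simp add: card_gt_0_iff zero_power prod_nonneg sum_nonneg)
next
  case False
  define n where "n = card K"
  define S where "S = (\<lambda>k. \<Sum>i\<in>I. a k i)"
  define R where "R = root n (\<Prod>k\<in>K. S k)"
  have n: "n > 0" using assms by (simp add: n_def card_gt_0_iff)
  have S: "S k > 0" if "k \<in> K" for k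
    using False a that by (metis S_def sum_nonneg less_eq_real_def)
  then have "(\<Prod>k\<in>K. S k) > 0" by (simp add: prod_pos)
  then have R: "R > 0" "R ^ n = (\<Prod>k\<in>K. S k)"
    using n by (simp_all add: R_def)
  \<comment> \<open>AM-GM: \<open>b i / R\<close> is the geometric mean of the normalised values.
    Summing the right-hand side over \<open>i\<close> gives 1, hence the sum of the
    \<open>b i\<close> is at most \<open>R\<close>.\<close>
  have "b i / R \<le> (\<Sum>k\<in>K. a k i / S k / n)" if i: "i \<in> I" for i
  proof -
    have "(\<Prod>k\<in>K. a k i / S k) = (b i / R) ^ n"
      using ab[OF i] R(2) by (simp add: prod_dividef power_divide n_def)
    moreover have "((b i / R) ^ n) powr (1 / n) = b i / R"
    proof (cases "b i = 0")
      case False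
      then show ?thesis
        using b[OF i] R(1) n by (simp add: powr_realpow [symmetric] powr_powr)
    qed (use n in \<open>simp add: zero_power\<close>)
    moreover have "a k i / S k \<ge> 0" if "k \<in> K" for k
      using a[OF that i] S[OF that] by simp
    ultimately show ?thesis
      using arith_geom_mean[of K "\<lambda>k. a k i / S k"] assms(1,2) by (simp add: n_def)
  qed
  then have "(\<Sum>i\<in>I. b i / R) \<le> (\<Sum>i\<in>I. \<Sum>k\<in>K. a k i / S k / n)"
    by (rule sum_mono)
  also have "\<dots> = (\<Sum>k\<in>K. \<Sum>i\<in>I. a k i / S k / n)" by (rule sum.swap)
  also have "\<dots> = (\<Sum>k\<in>K. S k / S k / n)"
    by (simp only: S_def sum_divide_distrib)
  also have "\<dots> = (\<Sum>k\<in>K. 1 / n)"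
    using S by (intro sum.cong) (auto simp: less_imp_neq [symmetric])
  also have "\<dots> = 1" using n by (simp add: n_def)
  finally have "(\<Sum>i\<in>I. b i) \<le> R"
    using R(1) by (simp add: sum_divide_distrib [symmetric])
  then have "(\<Sum>i\<in>I. b i) ^ n \<le> R ^ n"
    using b by (intro power_mono) (simp_all add: sum_nonneg)
  then show ?thesis using R(2) by (simp add: n_def S_def)
qed

section \<open>Expansion of \<open>E_tilde\<close> in elementary symmetric polynomials\<close>

lemma sum_by_card:
  "(\<Sum>r=0..m. \<Sum>X | X \<subseteq> {1..m} \<and> card X = r. h X) = (\<Sum>X\<in>Pow {1..m::nat}. h X)"
proof -
  have "card ` Pow {1..m} \<subseteq> {0..m}"
    using card_mono[of "{1..m}"] by fastforce
  from sum.group[OF _ _ this, of h] show ?thesis by (simp add: Pow_def)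
qed

text \<open>If \<open>X\<close> is the set of factors contributing their constant term, the power of
  the variable is \<open>m - card X\<close>; grouping by \<open>card X\<close> collects
  \<open>elem_sym\<close>.\<close>

lemma prod_linear_eq_sum_elem_sym:
  "(\<Prod>i=1..m. [:complex_of_real (l i), 1:]) =
     (\<Sum>r=0..m. monom (complex_of_real (elem_sym m l r)) (m - r))"
proof -
  have const: "(\<Prod>i\<in>X. [:complex_of_real (l i):]) = [:complex_of_real (\<Prod>i\<in>X. l i):]" for X
    by (induction X rule: infinite_finite_induct) (simp_all add: one_pCons)
  have "(\<Prod>i=1..m. [:complex_of_real (l i), 1:]) =
        (\<Prod>i=1..m. [:complex_of_real (l i):] + monom 1 1)"
    by (simp add: monom_altdef)
  also have "\<dots> = (\<Sum>X\<in>Pow {1..m}. [:complex_of_real (\<Prod>i\<in>X. l i):] * monom 1 (m - card X))"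
    unfolding prod_add[OF finite_atLeastAtMost] const
    by (intro sum.cong refl)
       (simp add: monom_power card_Diff_subset finite_subset[of _ "{Suc 0..m}"])
  also have "\<dots> = (\<Sum>r=0..m. \<Sum>X | X \<subseteq> {1..m} \<and> card X = r.
                     monom (complex_of_real (\<Prod>i\<in>X. l i)) (m - card X))"
    unfolding sum_by_card by (simp add: smult_monom)
  also have "\<dots> = (\<Sum>r=0..m. monom (complex_of_real (elem_sym m l r)) (m - r))"
    by (intro sum.cong refl)
       (simp add: elem_sym_def poly_eq_iff coeff_sum)
  finally show ?thesis .
qed

lemma degree_h_poly: "degree (h_poly n) = n - 1"
  unfolding h_poly_def by (subst degree_prod_sum_eq) simp_all

lemma E_tilde_eq:
  assumes "k < m + n" "n \<ge> 1"
  shows "E_tilde m n l k =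
    (\<Sum>r=0..m. if r \<le> k \<and> k - r < n then c_coeff n (k - r) * elem_sym m l r else 0)"
proof -
  let ?d = "m + n - 1 - k"
  have "E_tilde m n l k =
      Re (coeff (\<Sum>r=0..m. monom (complex_of_real (elem_sym m l r)) (m - r) * h_poly n) ?d)"
    using assms(1) unfolding E_tilde_def hl_poly_def prod_linear_eq_sum_elem_sym
    by (simp add: sum_distrib_right mult.commute[of "h_poly n"])
  also have "\<dots> = (\<Sum>r=0..m. if ?d < m - r then 0
      else elem_sym m l r * Re (coeff (h_poly n) (?d - (m - r))))"
    by (simp add: coeff_sum coeff_monom_mult if_distrib[of Re] cong: if_cong)
  also have "\<dots> = (\<Sum>r=0..m. if r \<le> k \<and> k - r < n then c_coeff n (k - r) * elem_sym m l r else 0)"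
  proof (intro sum.cong refl)
    fix r assume r: "r \<in> {0..m}"
    \<comment> \<open>The index of \<open>c_coeff\<close> is \<open>k - r\<close>. In the second
      case the monomial already has degree above \<open>?d\<close>; in the third the required
      coefficient lies above the degree of \<open>h_poly n\<close>.\<close>
    consider "r \<le> k" "k - r < n" | "r \<le> k" "k - r \<ge> n" | "r > k" by linarith
    then show "(if ?d < m - r then 0
        else elem_sym m l r * Re (coeff (h_poly n) (?d - (m - r)))) =
      (if r \<le> k \<and> k - r < n then c_coeff n (k - r) * elem_sym m l r else 0)"
    proof cases
      case 1
      then have "?d - (m - r) = n - 1 - (k - r)" "\<not> ?d < m - r" using r assms by auto
      then show ?thesis using 1 by (simp add: c_coeff_def)
    next
      case 2
      then have "?d < m - r" using r assms by auto
      then show ?thesis using 2 by simp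
    next
      case 3
      then have "?d - (m - r) > n - 1" using r assms by auto
      then have "coeff (h_poly n) (?d - (m - r)) = 0"
        by (intro coeff_eq_0) (simp add: degree_h_poly)
      then show ?thesis using 3 by simp
    qed
  qed
  finally show ?thesis .
qed

section \<open>Nonnegativity of the c_j\<close>

lemma nonneg_Reals_sum:
  "(\<And>x. x \<in> A \<Longrightarrow> f x \<in> \<real>\<^sub>\<ge>\<^sub>0) \<Longrightarrow> sum f A \<in> (\<real>\<^sub>\<ge>\<^sub>0 :: complex set)"
  by (induction A rule: infinite_finite_induct) auto

lemma coeff_mult_nonneg_Reals:
  fixes p q :: "complex poly"
  assumes "\<And>i. coeff p i \<in> \<real>\<^sub>\<ge>\<^sub>0" "\<And>i. coeff q i \<in> \<real>\<^sub>\<ge>\<^sub>0"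
  shows "coeff (p * q) i \<in> \<real>\<^sub>\<ge>\<^sub>0"
  unfolding coeff_mult using assms by (intro nonneg_Reals_sum nonneg_Reals_mult_I)

lemma coeff_prod_nonneg_Reals:
  fixes f :: "'a \<Rightarrow> complex poly"
  assumes "\<And>x i. x \<in> A \<Longrightarrow> coeff (f x) i \<in> \<real>\<^sub>\<ge>\<^sub>0"
  shows "coeff (prod f A) i \<in> \<real>\<^sub>\<ge>\<^sub>0"
  using assms
proof (induction A arbitrary: i rule: infinite_finite_induct)
  case (insert x A)
  then show ?case by (simp add: coeff_mult_nonneg_Reals)
qed (auto simp: coeff_1)

text \<open>
  The conjugate factors \<open>s\<close> and \<open>n - s\<close> multiply to \<open>y\<^sup>2 + 2 sin(\<pi> s/n) y + 1\<close>.
\<close>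

lemma c_coeff_nonneg: "c_coeff n j \<ge> 0"
proof -
  let ?r = "\<lambda>s. \<i> * exp (\<i> * complex_of_real (pi * real s / real n))"
  let ?f = "\<lambda>s. [:- ?r s, 1:]"
  \<comment> \<open>The reflection \<open>s\<close> to \<open>n - s\<close> exchanges
    \<open>A\<close> and \<open>C\<close>. \<open>B\<close> holds the self-paired index, which
    exists only for even \<open>n\<close> and gives the factor y + 1.\<close>
  define A where "A = {s. 1 \<le> s \<and> 2 * s < n}"
  define B where "B = {s. 1 \<le> s \<and> 2 * s = n}"
  define C where "C = {s. n < 2 * s \<and> s \<le> n - 1}"
  have fin: "finite A" "finite B" "finite C"
    unfolding A_def B_def C_def by (auto intro: finite_subset[of _ "{..n}"])
  have split: "{1..n-1} = (A \<union> C) \<union> B" by (auto simp: A_def B_def C_def)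
  have "h_poly n = (prod ?f A * prod ?f C) * prod ?f B"
    unfolding h_poly_def split using fin
    by (subst prod.union_disjoint, (auto simp: A_def B_def C_def)[3],
        subst prod.union_disjoint, auto simp: A_def B_def C_def)
  also have "prod ?f C = (\<Prod>s\<in>A. ?f (n - s))"
    by (rule prod.reindex_bij_witness[where i = "\<lambda>s. n - s" and j = "\<lambda>s. n - s"])
       (auto simp: A_def C_def)
  finally have h: "h_poly n = (\<Prod>s\<in>A. ?f s * ?f (n - s)) * prod ?f B"
    by (simp only: prod.distrib)
  have "coeff (?f s * ?f (n - s)) i \<in> \<real>\<^sub>\<ge>\<^sub>0" if s: "s \<in> A" for s i
  proof -
    have s': "1 \<le> s" "s \<le> n - 1" "2 * s < n" using s by (auto simp: A_def)
    have "pi * real s / real n \<le> pi" using s' by (simp add: field_simps)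
    then have sin: "sin (pi * real s / real n) \<ge> 0" by (intro sin_ge_zero) auto
    have "?f s * ?f (n - s) = [:- ?r s, 1:] * [:- cnj (?r s), 1:]"
      using cnj_i_exp[OF s'(1,2)] by simp
    also have "\<dots> = [:?r s * cnj (?r s), - (?r s + cnj (?r s)), 1:]"
      by (simp add: algebra_simps)
    also have "?r s * cnj (?r s) = 1"
      unfolding complex_norm_square [symmetric] by (simp add: norm_mult)
    also have "- (?r s + cnj (?r s)) = complex_of_real (2 * sin (pi * real s / real n))"
      unfolding cis_conv_exp [symmetric] by (simp only: complex_eq_iff) simp
    finally show ?thesis using sin
      by (simp only: coeff_pCons split: nat.split) auto
  qed
  moreover have "coeff (?f s) i \<in> \<real>\<^sub>\<ge>\<^sub>0" if s: "s \<in> B" for s i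
  proof -
    have "?r s = \<i> * cis (pi / 2)"
      using s by (auto simp: B_def cis_conv_exp)
    then have "?r s = - 1" by (simp add: cis_pi_half)
    then show ?thesis by (simp only: coeff_pCons split: nat.split) auto
  qed
  ultimately have "coeff (h_poly n) i \<in> \<real>\<^sub>\<ge>\<^sub>0" for i
    unfolding h
    by (rule coeff_mult_nonneg_Reals[OF coeff_prod_nonneg_Reals coeff_prod_nonneg_Reals])
  then show ?thesis by (auto simp: c_coeff_def complex_nonneg_Reals_iff)
qed

section \<open>Products of the largest \<lambda>_i\<close>

lemma elem_sym_nonneg:
  "(\<And>i. i \<in> {1..m} \<Longrightarrow> 0 < l i) \<Longrightarrow> elem_sym m l r \<ge> 0"
  unfolding elem_sym_def by (intro sum_nonneg prod_nonneg) (auto intro!: less_imp_le)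

text \<open>Induction on \<open>m\<close>. If the top index lies in \<open>X\<close>, it is matched
  with the factor \<open>j = 0\<close> and removed; otherwise monotonicity raises every index of the
  inductive bound by one.\<close>

lemma prod_le_prod_largest:
  fixes l :: "nat \<Rightarrow> real"
  assumes "\<And>i. i \<in> {1..m} \<Longrightarrow> 0 < l i" "mono_on {1..m} l" "X \<subseteq> {1..m}"
  shows "(\<Prod>i\<in>X. l i) \<le> (\<Prod>j<card X. l (m - j))"
  using assms
proof (induction m arbitrary: X)
  case (Suc m)
  have fin: "finite X" using Suc.prems(3) finite_subset by blast
  have mono: "mono_on {1..m} l" using Suc.prems(2) by (rule mono_on_subset) auto
  note IH = Suc.IH[OF Suc.prems(1) mono]
  show ?case
  proof (cases "Suc m \<in> X")
    case True
    let ?Y = "X - {Suc m}"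
    have "?Y \<subseteq> {1..m}" using Suc.prems(3) by (auto simp: atLeastAtMostSuc_conv)
    then have "(\<Prod>i\<in>?Y. l i) \<le> (\<Prod>j<card ?Y. l (m - j))" by (intro IH) auto
    then have "l (Suc m) * (\<Prod>i\<in>?Y. l i) \<le> l (Suc m) * (\<Prod>j<card ?Y. l (m - j))"
      using Suc.prems(1)[of "Suc m"] by (intro mult_left_mono) auto
    also have "\<dots> = (\<Prod>j<Suc (card ?Y). l (Suc m - j))"
      unfolding prod.lessThan_Suc_shift by simp
    also have "Suc (card ?Y) = card X"
      using fin True by (rule card_Suc_Diff1)
    finally show ?thesis
      unfolding prod.remove[OF fin True] .
  next
    case False
    have X: "X \<subseteq> {1..m}" using Suc.prems(3) False by (auto simp: atLeastAtMostSuc_conv)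
    then have card: "card X \<le> m" using card_mono[of "{1..m}" X] by simp
    have "(\<Prod>i\<in>X. l i) \<le> (\<Prod>j<card X. l (m - j))" using X by (intro IH) auto
    also have "\<dots> \<le> (\<Prod>j<card X. l (Suc m - j))"
      using card Suc.prems(1)
      by (intro prod_mono conjI mono_onD[OF Suc.prems(2)] less_imp_le[OF Suc.prems(1)]) auto
    finally show ?thesis .
  qed
qed simp

lemma prod_one_plus_square_le:
  fixes l :: "nat \<Rightarrow> real"
  assumes "\<And>i. i \<in> {1..m} \<Longrightarrow> 0 < l i" "mono_on {1..m} l"
  shows "(\<Prod>i=1..m. 1 + (l i)\<^sup>2) \<le> (\<Sum>r=0..m. (\<Prod>j<r. l (m - j)) * elem_sym m l r)"
proof -
  have "(\<Prod>i=1..m. 1 + (l i)\<^sup>2) = (\<Prod>i=1..m. (l i)\<^sup>2 + 1)" by (simp add: add.commute)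
  also have "\<dots> = (\<Sum>X\<in>Pow {1..m}. \<Prod>i\<in>X. (l i)\<^sup>2)"
    by (subst prod_add) simp_all
  also have "\<dots> \<le> (\<Sum>X\<in>Pow {1..m}. (\<Prod>j<card X. l (m - j)) * (\<Prod>i\<in>X. l i))"
  proof (rule sum_mono)
    fix X assume X: "X \<in> Pow {1..m}"
    then have "(\<Prod>i\<in>X. l i) \<ge> 0" using assms(1) by (intro prod_nonneg) (auto intro!: less_imp_le)
    then show "(\<Prod>i\<in>X. (l i)\<^sup>2) \<le> (\<Prod>j<card X. l (m - j)) * (\<Prod>i\<in>X. l i)"
      using prod_le_prod_largest[OF assms] X
      by (auto simp: power2_eq_square prod.distrib intro: mult_right_mono)
  qed
  also have "\<dots> = (\<Sum>r=0..m. (\<Prod>j<r. l (m - j)) * elem_sym m l r)"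
    unfolding sum_by_card [symmetric] elem_sym_def sum_distrib_left
    by (intro sum.cong refl) auto
  finally show ?thesis .
qed

section \<open>Residue classes modulo n\<close>

text \<open>
  In \<open>f_num m n l k\<close>, the elementary symmetric polynomial \<open>E\<^sub>r\<close> occurs in exactly one summand,
  namely \<open>s = \<lceil>(r - k)/n\<rceil>\<close>, since \<open>k + s n - r\<close> has to lie in \<open>{0..<n}\<close>.
\<close>

definition block_index :: "nat \<Rightarrow> nat \<Rightarrow> nat \<Rightarrow> nat" where
  "block_index n k r = (r + n - 1 - k) div n"

text \<open>The numbers below \<open>r\<close> congruent to \<open>k\<close> modulo \<open>n\<close>
  are \<open>(j - 1) * n + k\<close> for \<open>j = 1, 2, ...\<close>, so
  \<open>block_index n k r\<close> counts them.\<close>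

lemma le_block_index_iff:
  assumes "k < n" "j \<ge> 1"
  shows "j \<le> block_index n k r \<longleftrightarrow> (j - 1) * n + k < r"
proof -
  have "j \<le> block_index n k r \<longleftrightarrow> j * n \<le> r + n - 1 - k"
    using assms by (simp add: block_index_def less_eq_div_iff_mult_less_eq)
  also have "\<dots> \<longleftrightarrow> (j - 1) * n + k < r"
    using assms by (cases j) auto
  finally show ?thesis .
qed

lemma block_index_bounds:
  assumes "k < n"
  shows "r \<le> k + block_index n k r * n" "k + block_index n k r * n - r < n"
proof -
  have n: "n > 0" using assms by simp
  let ?q = "r + n - 1 - k"
  have "?q = block_index n k r * n + ?q mod n" by (simp add: block_index_def)
  moreover have "?q mod n < n" using n by simp
  ultimately show "r \<le> k + block_index n k r * n" "k + block_index n k r * n - r < n"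
    using assms by linarith+
qed

text \<open>The index is congruent to \<open>k - r\<close> modulo \<open>n\<close> and lies below
  \<open>n\<close>, so it permutes the residues as \<open>k\<close> varies.\<close>

lemma prod_block_residues:
  fixes c :: "nat \<Rightarrow> 'a :: comm_monoid_mult"
  shows "(\<Prod>k<n. c (k + block_index n k r * n - r)) = (\<Prod>j<n. c j)"
proof -
  let ?g = "\<lambda>k. k + block_index n k r * n - r"
  have g: "?g ` {..<n} \<subseteq> {..<n}" using block_index_bounds(2) by auto
  have "inj_on ?g {..<n}"
  proof (rule inj_onI)
    fix k k' assume k: "k \<in> {..<n}" "k' \<in> {..<n}" "?g k = ?g k'"
    then have "k + block_index n k r * n = k' + block_index n k' r * n"
      using block_index_bounds(1)[of k n r] block_index_bounds(1)[of k' n r] by simp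
    then have "(k + block_index n k r * n) mod n = (k' + block_index n k' r * n) mod n" by simp
    then show "k = k'" using k by simp
  qed
  moreover from this have "?g ` {..<n} = {..<n}"
    using g by (intro endo_inj_surj) auto
  ultimately have "bij_betw ?g {..<n} {..<n}" by (simp add: bij_betw_def)
  from prod.reindex_bij_betw[OF this] show ?thesis .
qed

text \<open>Division with remainder by \<open>n\<close> writes each \<open>t < r\<close> uniquely as
  \<open>(j - 1) * n + k\<close>. With \<open>g t = l (m - t) ^ n\<close> the right-hand side is the
  \<open>n\<close>-th power of the product of the \<open>r\<close> largest values.\<close>

lemma prod_blocks:
  fixes g :: "nat \<Rightarrow> 'a :: comm_monoid_mult"
  assumes "n \<ge> 1"
  shows "(\<Prod>k<n. \<Prod>j=1..block_index n k r. g ((j - 1) * n + k)) = (\<Prod>t<r. g t)"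
proof -
  have "(\<Prod>k<n. \<Prod>j=1..block_index n k r. g ((j - 1) * n + k)) =
        (\<Prod>(k, j)\<in>Sigma {..<n} (\<lambda>k. {1..block_index n k r}). g ((j - 1) * n + k))"
    by (rule prod.Sigma) auto
  also have "\<dots> = (\<Prod>t<r. g t)"
    by (rule prod.reindex_bij_witness[where i = "\<lambda>t. (t mod n, t div n + 1)"
          and j = "\<lambda>(k, j). (j - 1) * n + k"])
       (use assms in \<open>auto simp: le_block_index_iff\<close>)
  finally show ?thesis .
qed

section \<open>Lower bound for f_k and conclusion\<close>

text \<open>Insert \<open>E_tilde_eq\<close> into \<open>f_num\<close> and exchange the sums over
  \<open>s\<close> and \<open>r\<close>. All terms are nonnegative, so for each \<open>r\<close> the
  term \<open>s = block_index n k r\<close> is a lower bound for the inner sum.\<close>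

lemma f_num_ge:
  assumes k: "k < n" and pos: "\<And>i. i \<in> {1..m} \<Longrightarrow> 0 < l i"
  shows "f_num m n l k \<ge> (\<Sum>r=0..m. (\<Prod>j=1..block_index n k r. l (m - ((j - 1) * n + k)) ^ n) *
           (c_coeff n (k + block_index n k r * n - r) * elem_sym m l r))"
proof -
  let ?S = "{s. k + s * n \<le> m + n - 1}"
  let ?W = "\<lambda>s. \<Prod>j=1..s. l (m - ((j - 1) * n + k)) ^ n"
  let ?e = "\<lambda>s r. if r \<le> k + s * n \<and> k + s * n - r < n
                  then c_coeff n (k + s * n - r) * elem_sym m l r else 0"
  have n: "n \<ge> 1" using k by simp
  have "s \<le> m + n" if "s \<in> ?S" for s
  proof -
    have "s \<le> s * n" using n by (cases n) auto
    then show ?thesis using that unfolding mem_Collect_eq by linarith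
  qed
  then have fin: "finite ?S" by (intro finite_subset[of ?S "{..m + n}"]) auto
  \<comment> \<open>This puts the indices into the form \<open>m - t\<close> with
    \<open>t = (j - 1) * n + k\<close>, as \<open>prod_blocks\<close> expects.\<close>
  have idx: "m + n - j * n - k = m - ((j - 1) * n + k)" if "j \<ge> 1" for j
    using that by (cases j) auto
  have W: "?W s \<ge> 0" if s: "s \<in> ?S" for s
  proof (intro prod_nonneg ballI zero_le_power less_imp_le[OF pos])
    fix j assume j: "j \<in> {1..s}"
    then have "(j - 1) * n + n \<le> s * n"
      using mult_le_mono1[of j s n] by (cases j) auto
    then show "m - ((j - 1) * n + k) \<in> {1..m}" using s n by auto
  qed
  have nonneg: "?W s * ?e s r \<ge> 0" if "s \<in> ?S" for s r
    using W[OF that] c_coeff_nonneg elem_sym_nonneg[OF pos] by auto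
  have "(\<Sum>r=0..m. ?W (block_index n k r) *
           (c_coeff n (k + block_index n k r * n - r) * elem_sym m l r))
        \<le> (\<Sum>r=0..m. \<Sum>s\<in>?S. ?W s * ?e s r)"
  proof (rule sum_mono)
    fix r assume r: "r \<in> {0..m}"
    let ?s = "block_index n k r"
    note b = block_index_bounds[OF k, of r]
    \<comment> \<open>By the second bound \<open>k + ?s * n < n + r\<close>, and \<open>r\<close> is
      at most \<open>m\<close>.\<close>
    have s: "?s \<in> ?S" using b r by auto
    have "?W ?s * ?e ?s r \<le> (\<Sum>s\<in>?S. ?W s * ?e s r)"
      using s fin nonneg by (intro member_le_sum) auto
    then show "?W ?s * (c_coeff n (k + ?s * n - r) * elem_sym m l r)
        \<le> (\<Sum>s\<in>?S. ?W s * ?e s r)"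
      using b by simp
  qed
  also have "\<dots> = (\<Sum>s\<in>?S. ?W s * (\<Sum>r=0..m. ?e s r))"
    by (subst sum.swap) (simp add: sum_distrib_left)
  also have "\<dots> = f_num m n l k"
    unfolding f_num_def
  proof (intro sum.cong refl arg_cong2[where f = "(*)"])
    fix s assume "s \<in> ?S"
    then show "(\<Sum>r=0..m. ?e s r) = E_tilde m n l (k + s * n)"
      using n by (subst E_tilde_eq) auto
    show "?W s = (\<Prod>j=1..s. l (m + n - j * n - k) ^ n)"
      by (intro prod.cong refl) (simp only: idx atLeastAtMost_iff)
  qed
  finally show ?thesis .
qed

theorem theorem4p2:
  fixes m n :: nat and l :: "nat \<Rightarrow> real"
  assumes "m \<ge> 1" and "n \<ge> 1"
    and "\<And>i. i \<in> {1..m} \<Longrightarrow> 0 < l i"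
    and "strict_mono_on {1..m} l"
  shows "(\<Prod>k<n. f_num m n l k) \<ge>
           (\<Prod>k<n. c_coeff n k) *
           (\<Sum>r=0..m. (\<Prod>j<r. l (m - j)) * elem_sym m l r) ^ n \<and>
         (\<Prod>k<n. f_num m n l k) \<ge>
           (\<Prod>k<n. c_coeff n k) * (\<Prod>i=1..m. (1 + (l i)\<^sup>2) ^ n)"
proof -
  note pos = assms(3)
  let ?P = "\<lambda>r. \<Prod>j<r. l (m - j)"
  let ?C = "\<Prod>k<n. c_coeff n k"
  let ?T = "\<Sum>r=0..m. ?P r * elem_sym m l r"
  let ?W = "\<lambda>k r. \<Prod>j=1..block_index n k r. l (m - ((j - 1) * n + k)) ^ n"
  let ?a = "\<lambda>k r. ?W k r * (c_coeff n (k + block_index n k r * n - r) * elem_sym m l r)"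
  have C: "?C \<ge> 0" by (intro prod_nonneg) (simp add: c_coeff_nonneg)
  have P: "?P r \<ge> 0" if "r \<in> {0..m}" for r
    using that by (intro prod_nonneg ballI less_imp_le[OF pos]) auto
  have a: "?a k r \<ge> 0" if "k < n" "r \<in> {0..m}" for k r
  proof -
    \<comment> \<open>Since \<open>(j - 1) * n + k < r\<close> and \<open>r\<close> is at most
      \<open>m\<close>, only values of \<open>l\<close> known to be positive occur.\<close>
    have "m - ((j - 1) * n + k) \<in> {1..m}" if "j \<in> {1..block_index n k r}" for j
      using that le_block_index_iff[OF \<open>k < n\<close>, of j r] \<open>r \<in> {0..m}\<close> by auto
    then have "?W k r \<ge> 0" by (intro prod_nonneg ballI zero_le_power less_imp_le[OF pos])
    then show ?thesis by (intro mult_nonneg_nonneg c_coeff_nonneg elem_sym_nonneg pos)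
  qed
  have prod_a: "(\<Prod>k<n. ?a k r) = ?C * (?P r * elem_sym m l r) ^ n" for r
  proof -
    have "(\<Prod>k<n. ?a k r) = (\<Prod>k<n. ?W k r) *
        ((\<Prod>k<n. c_coeff n (k + block_index n k r * n - r)) * (\<Prod>k<n. elem_sym m l r))"
      by (simp only: prod.distrib)
    also have "\<dots> = (\<Prod>t<r. l (m - t) ^ n) * (?C * elem_sym m l r ^ n)"
      unfolding prod_blocks[OF assms(2), of "\<lambda>t. l (m - t) ^ n" r] prod_block_residues by simp
    also have "\<dots> = ?C * (?P r * elem_sym m l r) ^ n"
      by (simp add: power_mult_distrib prod_power_distrib)
    finally show ?thesis .
  qed
  \<comment> \<open>Absorbing \<open>root n ?C\<close> into each summand makes its
    \<open>n\<close>-th power exactly the product in \<open>prod_a\<close>, as Hoelder's inequality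
    requires.\<close>
  have "?C * ?T ^ n = (\<Sum>r=0..m. root n ?C * (?P r * elem_sym m l r)) ^ card {..<n}"
    using C assms(2) by (simp add: sum_distrib_left [symmetric] power_mult_distrib)
  also have "\<dots> \<le> (\<Prod>k\<in>{..<n}. \<Sum>r=0..m. ?a k r)"
  proof (rule Holder_prod_sum)
    show "(root n ?C * (?P r * elem_sym m l r)) ^ card {..<n} = (\<Prod>k<n. ?a k r)" for r
      unfolding prod_a using C assms(2) by (simp add: power_mult_distrib)
    show "root n ?C * (?P r * elem_sym m l r) \<ge> 0" if "r \<in> {0..m}" for r
      using C by (intro mult_nonneg_nonneg P that elem_sym_nonneg pos real_root_ge_zero)
  qed (use assms(2) a in \<open>auto simp: lessThan_empty_iff\<close>)
  also have "\<dots> \<le> (\<Prod>k<n. f_num m n l k)"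
    using a by (intro prod_mono conjI sum_nonneg f_num_ge pos) auto
  finally have first: "?C * ?T ^ n \<le> (\<Prod>k<n. f_num m n l k)" .
  have "(\<Prod>i=1..m. (1 + (l i)\<^sup>2) ^ n) = (\<Prod>i=1..m. 1 + (l i)\<^sup>2) ^ n"
    by (rule prod_power_distrib [symmetric])
  also have "\<dots> \<le> ?T ^ n"
    using prod_one_plus_square_le[OF pos strict_mono_on_imp_mono_on[OF assms(4)]]
    by (intro power_mono prod_nonneg) auto
  finally have "?C * (\<Prod>i=1..m. (1 + (l i)\<^sup>2) ^ n) \<le> ?C * ?T ^ n"
    using C by (rule mult_left_mono)
  with first show ?thesis by linarith
qed

end
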